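(* Let $\boldsymbol{A}\in\mathbb{R}^{d\times d}$ be symmetric positive definite, let $\boldsymbol{G}_0$ be a random symmetric matrix such that $\boldsymbol{G}_0\succeq\boldsymbol{A}$ always holds, and let $\boldsymbol{L}_0$ be a square matrix with $\boldsymbol{L}_0^\top\boldsymbol{L}_0=\boldsymbol{G}_0^{-1}$. For $k\ge 0$ let $\boldsymbol{u}_k=\boldsymbol{L}_k^\top\tilde{\boldsymbol{u}}_k$, $\boldsymbol{G}_{k+1}=\mathrm{BFGS}(\boldsymbol{G}_k,\boldsymbol{A},\boldsymbol{u}_k)$, and let $\boldsymbol{L}_{k+1}$ be the factor with $\boldsymbol{L}_{k+1}^\top\boldsymbol{L}_{k+1}=\boldsymbol{G}_{k+1}^{-1}$ given in the context, where $\tilde{\boldsymbol{u}}_k$ is chosen either by (greedy method) $\tilde{\boldsymbol{u}}_k\in\arg\max_{\tilde{\boldsymbol{u}}\in\{\boldsymbol{e}_1,\dots,\boldsymbol{e}_d\}}\tilde{\boldsymbol{u}}^\top\boldsymbol{L}_k^{-\top}\boldsymbol{A}^{-1}\boldsymbol{L}_k^{-1}\tilde{\boldsymbol{u}}$, or (random method) $\tilde{\boldsymbol{u}}_k\sim\mathcal{D}$ independently of the past, where $\mathcal{D}$ is a fixed distribution on $\mathbb{R}^d$ (almost surely nonzero) with $\mathbb{E}_{\tilde{\boldsymbol{u}}\sim\mathcal{D}}\frac{\tilde{\boldsymbol{u}}\tilde{\boldsymbol{u}}^\top}{\tilde{\boldsymbol{u}}^\top\tilde{\boldsymbol{u}}}=\frac1d\boldsymbol{I}_d$.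 Let $\sigma_k=\mathrm{tr}(\boldsymbol{G}_k\boldsymbol{A}^{-1})-d$, and assume $\mathbb{E}\sigma_0<\infty$. Then, for either method, $$\forall k\ge 0:\quad\boldsymbol{G}_k\succeq\boldsymbol{A}\quad\text{and}\quad 0\le\mathbb{E}\,\sigma_k\le\left(1-\frac1d\right)^k\mathbb{E}\,\sigma_0 .$$ Therefore $\mathbb{E}\,\sigma_k$ converges to zero linearly.
   Context: $\preceq$ is the Loewner order; $\boldsymbol{e}_1,\dots,\boldsymbol{e}_d$ are the standard basis vectors; ties in the arg max are broken arbitrarily. BFGS update: for symmetric $\boldsymbol{G}\succeq\boldsymbol{A}\succ0$ and $\boldsymbol{u}\ne\boldsymbol{0}$, $\mathrm{BFGS}(\boldsymbol{G},\boldsymbol{A},\boldsymbol{u})=\boldsymbol{G}-\frac{\boldsymbol{G}\boldsymbol{u}\boldsymbol{u}^\top\boldsymbol{G}}{\boldsymbol{u}^\top\boldsymbol{G}\boldsymbol{u}}+\frac{\boldsymbol{A}\boldsymbol{u}\boldsymbol{u}^\top\boldsymbol{A}}{\boldsymbol{u}^\top\boldsymbol{A}\boldsymbol{u}}$. Factor update: $\boldsymbol{L}_{k+1}=\boldsymbol{L}_k-\frac{[\boldsymbol{L}_k\boldsymbol{A}\boldsymbol{u}_k-\boldsymbol{v}_k]\boldsymbol{u}_k^\top}{\boldsymbol{u}_k^\top\boldsymbol{A}\boldsymbol{u}_k}$ with $\boldsymbol{v}_k=\sqrt{\boldsymbol{u}_k^\top\boldsymbol{A}\boldsymbol{u}_k}\,\frac{\tilde{\boldsymbol{u}}_k}{\|\tilde{\boldsymbol{u}}_k\|}$;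 it satisfies $\boldsymbol{L}_{k+1}^\top\boldsymbol{L}_{k+1}=\boldsymbol{G}_{k+1}^{-1}$. The expectation is over $\boldsymbol{G}_0$ and all the directions (for the greedy method there is no randomness in the directions). A sequence $\{y_k\}$ converges to $y^*$ linearly (in the R-sense) if there is a scalar sequence $x_k\to 0$ with $\lim_{k\to\infty}|x_{k+1}|/|x_k|=q\in(0,1)$ and $|y_k-y^*|\le|x_k|$ for all $k\ge 0$. *)

theory Defs
  imports "HOL-Probability.Probability"
begin

definition sym_pos_def :: "real^'d^'d \<Rightarrow> bool" where
  "sym_pos_def A \<longleftrightarrow> transpose A = A \<and> (\<forall>x. x \<noteq> 0 \<longrightarrow> 0 < x \<bullet> (A *v x))"

definition loewner_le :: "real^'d^'d \<Rightarrow> real^'d^'d \<Rightarrow> bool" (infix "\<preceq>\<^sub>L" 50) where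
  "A \<preceq>\<^sub>L B \<longleftrightarrow> transpose A = A \<and> transpose B = B \<and> (\<forall>x. 0 \<le> x \<bullet> ((B - A) *v x))"

definition outer :: "real^'d \<Rightarrow> real^'d \<Rightarrow> real^'d^'d" where
  "outer x y = (\<chi> i j. x $ i * y $ j)"

text \<open>
  The two updates below are used for nonzero directions. For the zero direction all quotients
  are zero, so they return the given matrix unchanged; no case distinction is needed
  on the null event on which a random direction vanishes.
\<close>

definition BFGS :: "real^'d^'d \<Rightarrow> real^'d^'d \<Rightarrow> real^'d \<Rightarrow> real^'d^'d" where
  "BFGS G A u = G - (1 / (u \<bullet> (G *v u))) *\<^sub>R (G ** outer u u ** G)
                  + (1 / (u \<bullet> (A *v u))) *\<^sub>R (A ** outer u u ** A)"

definition bfgs_dir :: "real^'d^'d \<Rightarrow> real^'d \<Rightarrow> real^'d" where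
  "bfgs_dir L w = transpose L *v w"

definition factor_update :: "real^'d^'d \<Rightarrow> real^'d^'d \<Rightarrow> real^'d \<Rightarrow> real^'d^'d" where
  "factor_update L A w =
     (let u = bfgs_dir L w;
          a = u \<bullet> (A *v u);
          v = sqrt a *\<^sub>R ((1 / norm w) *\<^sub>R w)
      in L - (1 / a) *\<^sub>R outer (L *v (A *v u) - v) u)"

definition greedy_direction :: "real^'d^'d \<Rightarrow> real^'d^'d \<Rightarrow> real^'d \<Rightarrow> bool" where
  "greedy_direction A L w \<longleftrightarrow>
     is_arg_max (\<lambda>w. w \<bullet> ((transpose (matrix_inv L) ** matrix_inv A ** matrix_inv L) *v w))
                (\<lambda>w. w \<in> range (\<lambda>i. axis i 1)) w"

text \<open>
  Ties may be broken in any way for which the directions are random variables, as is needed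
  for expectations to make sense.
\<close>

definition greedy_method ::
  "'w measure \<Rightarrow> real^'d^'d \<Rightarrow> (nat \<Rightarrow> 'w \<Rightarrow> real^'d^'d) \<Rightarrow> (nat \<Rightarrow> 'w \<Rightarrow> real^'d) \<Rightarrow> bool" where
  "greedy_method M A L w \<longleftrightarrow>
     (\<forall>k. w k \<in> borel_measurable M) \<and>
     (\<forall>k. \<forall>\<omega>\<in>space M. greedy_direction A (L k \<omega>) (w k \<omega>))"

definition isotropic_distribution :: "(real^'d) measure \<Rightarrow> bool" where
  "isotropic_distribution D \<longleftrightarrow>
     prob_space D \<and> sets D = sets borel \<and> (AE w in D. w \<noteq> 0) \<and>
     (\<integral>w. (1 / (w \<bullet> w)) *\<^sub>R outer w w \<partial>D) = (1 / real CARD('d)) *\<^sub>R mat 1"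

text \<open>
  The past of step \<open>k\<close> consists of the initial matrices and the directions of the steps before
  \<open>k\<close>; it determines all iterates up to index \<open>k\<close>. Independence is
  stated for the generated sigma-algebras, since \<open>indep_var\<close> requires both variables to have
  values in the same type.
\<close>

definition random_method ::
  "'w measure \<Rightarrow> (real^'d) measure \<Rightarrow> ('w \<Rightarrow> real^'d^'d) \<Rightarrow> ('w \<Rightarrow> real^'d^'d) \<Rightarrow>
     (nat \<Rightarrow> 'w \<Rightarrow> real^'d) \<Rightarrow> bool" where
  "random_method M D G0 L0 w \<longleftrightarrow>
     (\<forall>k. w k \<in> borel_measurable M \<and> distr M borel (w k) = D \<and>
        prob_space.indep_set M
          (sets (vimage_algebra (space M) (\<lambda>\<omega>. (G0 \<omega>, L0 \<omega>, \<lambda>j\<in>{..<k}. w j \<omega>))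
             (borel \<Otimes>\<^sub>M borel \<Otimes>\<^sub>M (\<Pi>\<^sub>M j\<in>{..<k}. borel))))
          (sets (vimage_algebra (space M) (w k) borel)))"

definition bfgs_sigma :: "real^'d^'d \<Rightarrow> real^'d^'d \<Rightarrow> real" where
  "bfgs_sigma A G = trace (G ** matrix_inv A) - real CARD('d)"

definition converges_R_linearly :: "(nat \<Rightarrow> real) \<Rightarrow> real \<Rightarrow> bool" where
  "converges_R_linearly y l \<longleftrightarrow>
     (\<exists>x q. x \<longlonglongrightarrow> (0::real) \<and> 0 < q \<and> q < 1 \<and>
        (\<lambda>k. \<bar>x (Suc k)\<bar> / \<bar>x k\<bar>) \<longlonglongrightarrow> q \<and>
        (\<forall>k. \<bar>y k - l\<bar> \<le> \<bar>x k\<bar>))"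

end

theory Submission
  imports Defs
begin

text \<open>
  Write \<open>L\<close> for the factor of \<open>G\<close> and \<open>B = L\<^sup>-\<^sup>T A\<^sup>-\<^sup>1 L\<^sup>-\<^sup>1\<close>. Since \<open>L\<^sup>-\<^sup>1 = G L\<^sup>T\<close>, the direction
  \<open>u = L\<^sup>T w\<close> satisfies \<open>G u = L\<^sup>-\<^sup>1 w\<close> and \<open>u \<bullet> G u = w \<bullet> w\<close>, so one step
  changes \<open>\<sigma>\<close> to \<open>\<sigma> + 1 - (w \<bullet> B w) / (w \<bullet> w)\<close>. As \<open>tr B = tr (G A\<^sup>-\<^sup>1) = \<sigma> + d\<close>, the mean of the
  Rayleigh quotient is \<open>\<sigma> / d + 1\<close>, both over the standard basis (which the greedy choice
  dominates) and under an isotropic distribution independent of \<open>B\<close>. Moreover \<open>A \<preceq>\<^sub>L G\<close> gives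
  \<open>B \<ge> I\<close>, so \<open>\<sigma>\<close> is nonnegative and never increases along a path, which yields integrability.
\<close>

subsection \<open>The two updates\<close>

lemma trace_scaleR: "trace (c *\<^sub>R A) = c * trace A" for A :: "real^'n^'n"
  by (simp add: trace_def sum_distrib_left)

lemma outer_mult_vector: "outer x y *v z = (y \<bullet> z) *\<^sub>R x"
  by (simp add: vec_eq_iff outer_def matrix_vector_mult_def inner_vec_def sum_distrib_left
      sum_distrib_right algebra_simps)

lemma matrix_mult_outer_mult: "A ** outer x y ** B = outer (A *v x) (transpose B *v y)"
  by (simp add: matrix_eq matrix_vector_mul_assoc[symmetric] outer_mult_vector
      matrix_vector_mult_scaleR dot_lmul_matrix)

lemma trace_outer_mult: "trace (outer x y ** B) = y \<bullet> (B *v x)"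
proof -
  have "trace (outer x y ** B) = (\<Sum>i\<in>UNIV. \<Sum>k\<in>UNIV. x $ i * y $ k * B $ k $ i)"
    by (simp add: trace_def matrix_matrix_mult_def outer_def)
  also have "\<dots> = (\<Sum>k\<in>UNIV. \<Sum>i\<in>UNIV. x $ i * y $ k * B $ k $ i)"
    by (rule sum.swap)
  also have "\<dots> = y \<bullet> (B *v x)"
    by (simp add: inner_vec_def matrix_vector_mult_def sum_distrib_left algebra_simps)
  finally show ?thesis .
qed

lemma symmetric_inner: "x \<bullet> (A *v y) = (A *v x) \<bullet> y"
  if "transpose A = A" for A :: "real^'n^'n"
  using dot_lmul_matrix[of x A y] transpose_matrix_vector[of A x] that by simp

lemma matrix_inv_eqI: "matrix_inv A = B" if "A ** B = mat 1" for A B :: "real^'n^'n"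
proof -
  have "B ** A = mat 1"
    using that matrix_left_right_inverse by blast
  with that have "A ** matrix_inv A = mat 1 \<and> matrix_inv A ** A = mat 1"
    unfolding matrix_inv_def
    by (intro someI[where P = "\<lambda>X. A ** X = mat 1 \<and> X ** A = mat 1"]) simp
  then have "matrix_inv A ** (A ** B) = B"
    by (simp add: matrix_mul_assoc)
  then show ?thesis
    by (simp add: that)
qed

lemma sym_pos_def_matrix_inv:
  assumes "sym_pos_def A"
  shows "A ** matrix_inv A = mat 1" "matrix_inv A ** A = mat 1"
proof -
  have "\<forall>x. A *v x = 0 \<longrightarrow> x = 0"
    using assms unfolding sym_pos_def_def by force
  then obtain B where "B ** A = mat 1"
    using matrix_left_invertible_ker by blast
  then have "A ** B = mat 1"
    using matrix_left_right_inverse by blast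
  with \<open>B ** A = mat 1\<close> show "A ** matrix_inv A = mat 1" "matrix_inv A ** A = mat 1"
    using matrix_inv_eqI by auto
qed

lemma loewner_le_inner: "x \<bullet> (A *v x) \<le> x \<bullet> (B *v x)" if "A \<preceq>\<^sub>L B"
  using that by (simp add: loewner_le_def matrix_vector_mult_diff_rdistrib inner_diff_right)

lemma sym_pos_def_mono: "sym_pos_def B" if "sym_pos_def A" "A \<preceq>\<^sub>L B"
  using that loewner_le_inner[OF that(2)] unfolding sym_pos_def_def loewner_le_def
  by (auto intro: less_le_trans)

lemma sym_pos_def_inner_nonneg: "0 \<le> x \<bullet> (A *v x)" if "sym_pos_def A"
  using that unfolding sym_pos_def_def by (cases "x = 0") (auto intro: less_imp_le)

lemma symmetric_form_diff_scaleR: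
  fixes A :: "real^'n^'n"
  assumes "transpose A = A"
  shows "(x - t *\<^sub>R u) \<bullet> (A *v (x - t *\<^sub>R u))
         = x \<bullet> (A *v x) - 2 * t * (u \<bullet> (A *v x)) + t\<^sup>2 * (u \<bullet> (A *v u))"
proof -
  have "x \<bullet> (A *v u) = u \<bullet> (A *v x)"
    using symmetric_inner[OF assms] by (metis inner_commute)
  then show ?thesis
    by (simp add: algebra_simps inner_simps power2_eq_square)
qed

text \<open>With \<open>A p = G q = x\<close>, the nonnegative form of \<open>A\<close> at
  \<open>p - q\<close> expands to
  \<open>p \<bullet> x - 2 (q \<bullet> x) + q \<bullet> A q\<close>, and the last term is at most
  \<open>q \<bullet> G q = q \<bullet> x\<close>.\<close>

lemma matrix_inv_antimono:
  assumes "sym_pos_def A" "A \<preceq>\<^sub>L G"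
  shows "x \<bullet> (matrix_inv G *v x) \<le> x \<bullet> (matrix_inv A *v x)"
proof -
  define p q where "p = matrix_inv A *v x" and "q = matrix_inv G *v x"
  have sym: "transpose A = A" using assms unfolding sym_pos_def_def by simp
  have Ap: "A *v p = x"
    by (simp add: p_def matrix_vector_mul_assoc sym_pos_def_matrix_inv assms)
  have Gq: "G *v q = x"
    using sym_pos_def_matrix_inv[OF sym_pos_def_mono[OF assms]]
    by (simp add: q_def matrix_vector_mul_assoc)
  \<comment> \<open>The factor 1 fits the pattern of
    \<open>symmetric_form_diff_scaleR\<close>.\<close>
  have "0 \<le> (p - 1 *\<^sub>R q) \<bullet> (A *v (p - 1 *\<^sub>R q))"
    by (rule sym_pos_def_inner_nonneg[OF assms(1)])
  also have "\<dots> = p \<bullet> x - 2 * (q \<bullet> x) + q \<bullet> (A *v q)"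
    unfolding symmetric_form_diff_scaleR[OF sym] by (simp add: Ap)
  also have "q \<bullet> (A *v q) \<le> q \<bullet> x"
    using loewner_le_inner[OF assms(2), of q] by (simp add: Gq)
  finally show ?thesis
    by (simp add: p_def q_def inner_commute)
qed

section \<open>The BFGS update and the Loewner order\<close>

lemma BFGS_zero [simp]: "BFGS G A 0 = G"
  by (simp add: BFGS_def)

lemma BFGS_mult_vector:
  assumes "transpose G = G" "transpose A = A"
  shows "BFGS G A u *v x = G *v x - ((u \<bullet> (G *v x)) / (u \<bullet> (G *v u))) *\<^sub>R (G *v u)
                          + ((u \<bullet> (A *v x)) / (u \<bullet> (A *v u))) *\<^sub>R (A *v u)"
  using symmetric_inner[OF assms(1)] symmetric_inner[OF assms(2)] assms
  by (simp add: BFGS_def matrix_mult_outer_mult outer_mult_vector algebra_simps inner_commute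
      scaleR_matrix_vector_assoc[symmetric] del: transpose_matrix_vector)

lemma transpose_BFGS:
  assumes "transpose G = G" "transpose A = A"
  shows "transpose (BFGS G A u) = BFGS G A u"
proof -
  have sym: "G $ i $ j = G $ j $ i" "A $ i $ j = A $ j $ i" for i j
    using assms by (auto simp: transpose_def vec_eq_iff)
  have "BFGS G A u = G - (1 / (u \<bullet> (G *v u))) *\<^sub>R outer (G *v u) (G *v u)
                  + (1 / (u \<bullet> (A *v u))) *\<^sub>R outer (A *v u) (A *v u)"
    by (simp add: BFGS_def matrix_mult_outer_mult assms del: transpose_matrix_vector)
  then show ?thesis
    by (simp add: vec_eq_iff transpose_def outer_def mult.commute sym)
qed

text \<open>Both rank-one corrections complete a square: one attains the minimum over \<open>t\<close> of the
  form of \<open>G\<close> at \<open>x - t u\<close>, the other the minimum of the form of \<open>A\<close>.\<close>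

lemma loewner_le_BFGS:
  assumes A: "sym_pos_def A" and le: "A \<preceq>\<^sub>L G"
  shows "A \<preceq>\<^sub>L BFGS G A u"
proof (cases "u = 0")
  case False
  have G: "sym_pos_def G" using sym_pos_def_mono[OF A le] .
  have sym: "transpose G = G" "transpose A = A"
    using A G unfolding sym_pos_def_def by auto
  define g a where "g = u \<bullet> (G *v u)" and "a = u \<bullet> (A *v u)"
  have pos: "g > 0" "a > 0"
    using A G False unfolding sym_pos_def_def g_def a_def by auto
  have "0 \<le> x \<bullet> ((BFGS G A u - A) *v x)" for x
  proof -
    define s t where "s = u \<bullet> (A *v x)" and "t = u \<bullet> (G *v x)"
    \<comment> \<open>On the line through \<open>x\<close> in direction \<open>u\<close>, the form
      of \<open>G\<close> is least at \<open>x - c u\<close>, with minimum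
      \<open>x \<bullet> G x - t^2 / g\<close>.\<close>
    define c where "c = t / g"
    define y where "y = x - c *\<^sub>R u"
    have Ay: "u \<bullet> (A *v y) = s - c * a"
      by (simp add: y_def s_def a_def algebra_simps inner_simps)
    \<comment> \<open>This expression is the minimum of the form of \<open>A\<close> over that whole
      line, so it does not change when \<open>x\<close> is shifted to \<open>y\<close>.\<close>
    have "x \<bullet> (A *v x) - s\<^sup>2 / a = y \<bullet> (A *v y) - (u \<bullet> (A *v y))\<^sup>2 / a"
      unfolding Ay unfolding y_def symmetric_form_diff_scaleR[OF sym(2)] using pos
      by (simp add: a_def[symmetric] s_def[symmetric] field_simps power2_eq_square)
    also have "\<dots> \<le> y \<bullet> (A *v y)"
      using pos by simp
    also have "\<dots> \<le> y \<bullet> (G *v y)"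
      by (rule loewner_le_inner[OF le])
    also have "\<dots> = x \<bullet> (G *v x) - t\<^sup>2 / g"
      unfolding y_def c_def symmetric_form_diff_scaleR[OF sym(1)] using pos
      by (simp add: g_def[symmetric] t_def[symmetric] field_simps power2_eq_square)
    finally have "x \<bullet> (A *v x) \<le> x \<bullet> (G *v x) - t\<^sup>2 / g + s\<^sup>2 / a" by simp
    also have "\<dots> = x \<bullet> (BFGS G A u *v x)"
    proof -
      have "x \<bullet> (A *v u) = s" "x \<bullet> (G *v u) = t"
        using symmetric_inner[OF sym(1)] symmetric_inner[OF sym(2)]
        unfolding s_def t_def by (metis inner_commute)+
      then show ?thesis
        unfolding BFGS_mult_vector[OF sym]
        by (simp add: inner_simps s_def[symmetric] t_def[symmetric] g_def[symmetric]
            a_def[symmetric] power2_eq_square)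
    qed
    finally show ?thesis
      by (simp add: matrix_vector_mult_diff_rdistrib inner_diff_right)
  qed
  with sym transpose_BFGS[OF sym] show ?thesis
    unfolding loewner_le_def by auto
qed (use le in simp)

section \<open>Factors of the inverse and the factor update\<close>

text \<open>Its proof goes through the \<open>v*\<close> form. Afterwards
  \<open>transpose_matrix_vector\<close> leaves the simpset, so that products keep the form
  \<open>transpose A *v x\<close> used from here on.\<close>

lemma transpose_inner: "(transpose A *v x) \<bullet> y = x \<bullet> (A *v y)" for A :: "real^'n^'m"
  by (simp add: dot_lmul_matrix)

declare transpose_matrix_vector [simp del]

text \<open>For square matrices a one-sided inverse is two-sided, so \<open>L^T (L G) = I\<close>
  may be reordered. Writing \<open>L^-1\<close> as \<open>G L^T\<close> later also yields its
  measurability.\<close>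

lemma factor_matrix_inv:
  fixes G L :: "real^'n^'n"
  assumes "sym_pos_def G" "transpose L ** L = matrix_inv G"
  shows "L ** (G ** transpose L) = mat 1" and "matrix_inv L = G ** transpose L"
proof -
  have "transpose L ** (L ** G) = mat 1"
    using sym_pos_def_matrix_inv(2)[OF assms(1)] assms(2) by (simp add: matrix_mul_assoc)
  then have "(L ** G) ** transpose L = mat 1"
    using matrix_left_right_inverse by blast
  then show "L ** (G ** transpose L) = mat 1"
    by (simp add: matrix_mul_assoc)
  then show "matrix_inv L = G ** transpose L"
    by (rule matrix_inv_eqI)
qed

lemma bfgs_dir_zero [simp]: "bfgs_dir L 0 = 0"
  by (simp add: bfgs_dir_def)

text \<open>All three rest on \<open>G L^T = L^-1\<close>; the second identity shows that
  \<open>u\<close> vanishes only together with \<open>w\<close>.\<close>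

lemma factor_bfgs_dir:
  assumes "sym_pos_def G" "transpose L ** L = matrix_inv G"
  shows "G *v bfgs_dir L w = matrix_inv L *v w"
    and "bfgs_dir L w \<bullet> (G *v bfgs_dir L w) = w \<bullet> w"
    and "bfgs_dir L w = 0 \<longleftrightarrow> w = 0"
proof -
  show 1: "G *v bfgs_dir L w = matrix_inv L *v w"
    by (simp add: bfgs_dir_def factor_matrix_inv(2)[OF assms] matrix_vector_mul_assoc)
  have "L *v (G *v bfgs_dir L w) = w"
    using factor_matrix_inv(1)[OF assms]
    by (simp add: bfgs_dir_def matrix_vector_mul_assoc matrix_mul_assoc)
  then show 2: "bfgs_dir L w \<bullet> (G *v bfgs_dir L w) = w \<bullet> w"
    by (simp add: bfgs_dir_def transpose_inner)
  then show "bfgs_dir L w = 0 \<longleftrightarrow> w = 0"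
    by (metis bfgs_dir_zero inner_eq_zero_iff inner_zero_left)
qed

lemma factor_update_zero [simp]: "factor_update L A 0 = L"
  by (simp add: factor_update_def)

text \<open>It suffices that the updated \<open>G\<close> undoes \<open>L'^T L'\<close> on every
  vector \<open>x\<close>. Subtracting a multiple of \<open>A u\<close> from \<open>x\<close> leaves
  \<open>y\<close> orthogonal to \<open>u\<close>; then \<open>L'^T L' x\<close> is
  \<open>G^-1 y\<close> plus a multiple of \<open>u\<close>, and the BFGS update sends this back to
  \<open>x\<close>.\<close>

lemma factor_update_factor:
  assumes A: "sym_pos_def A" and le: "A \<preceq>\<^sub>L G" and L: "transpose L ** L = matrix_inv G"
  shows "transpose (factor_update L A w) ** factor_update L A w
         = matrix_inv (BFGS G A (bfgs_dir L w))"
proof (cases "w = 0")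
  case False
  have G: "sym_pos_def G" using sym_pos_def_mono[OF A le] .
  have sym: "transpose G = G" "transpose A = A"
    using A G unfolding sym_pos_def_def by auto
  define u where "u = bfgs_dir L w"
  define a where "a = u \<bullet> (A *v u)"
  define H where "H = matrix_inv G"
  have "u \<noteq> 0" using factor_bfgs_dir(3)[OF G L] False by (simp add: u_def)
  then have a: "a > 0" using A unfolding a_def sym_pos_def_def by auto
  define n where "n = norm w"
  have n: "n > 0" using False by (simp add: n_def)
  have ww: "w \<bullet> w = n * n" by (simp add: n_def dot_square_norm power2_eq_square)
  have uGu: "u \<bullet> (G *v u) = n * n"
    using factor_bfgs_dir(2)[OF G L] by (simp add: u_def ww)
  have GH: "G *v (H *v x) = x" for x
    using sym_pos_def_matrix_inv(1)[OF G] by (simp add: matrix_vector_mul_assoc H_def)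
  have LtL: "transpose L *v (L *v x) = H *v x" for x
    by (simp add: matrix_vector_mul_assoc L H_def)
  have Ltw: "transpose L *v w = u" by (simp add: u_def bfgs_dir_def)
  define L' where "L' = factor_update L A w"
  \<comment> \<open>The bracket \<open>L A u - v\<close> of the factor update, with \<open>v\<close>
    written out.\<close>
  define p where "p = L *v (A *v u) - (sqrt a / n) *\<^sub>R w"
  have L': "L' = L - (1 / a) *\<^sub>R outer p u"
    by (simp add: L'_def factor_update_def Let_def p_def u_def a_def n_def)
  have L'x: "L' *v x = L *v x - ((u \<bullet> x) / a) *\<^sub>R p" for x
    by (simp add: L' matrix_vector_mult_diff_rdistrib outer_mult_vector
        scaleR_matrix_vector_assoc[symmetric])
  have L'tz: "transpose L' *v z = transpose L *v z - ((p \<bullet> z) / a) *\<^sub>R u" for z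
  proof -
    have "transpose L' = transpose L - (1 / a) *\<^sub>R outer u p"
      by (simp add: L' vec_eq_iff transpose_def outer_def mult.commute)
    then show ?thesis
      by (simp add: matrix_vector_mult_diff_rdistrib outer_mult_vector
        scaleR_matrix_vector_assoc[symmetric])
  qed
  have sa: "sqrt a * sqrt a = a" using a by simp
  have "BFGS G A u *v (transpose L' *v (L' *v x)) = x" for x
  proof -
    \<comment> \<open>In \<open>L' x\<close>, the term \<open>L A u\<close> of \<open>p\<close>
      turns \<open>L x\<close> into \<open>L y\<close>, while \<open>v\<close> contributes
      \<open>c w\<close>.\<close>
    define y where "y = x - ((u \<bullet> x) / a) *\<^sub>R (A *v u)"
    define c where "c = (u \<bullet> x) / a * (sqrt a / n)"
    define z where "z = L *v y + c *\<^sub>R w"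
    have z: "L' *v x = z"
      unfolding L'x p_def z_def y_def c_def
      by (simp add: algebra_simps matrix_vector_mult_scaleR)
    have uy: "u \<bullet> y = 0"
      using a by (simp add: y_def inner_simps a_def[symmetric])
    have Lz: "transpose L *v z = H *v y + c *\<^sub>R u"
      by (simp add: z_def matrix_vector_right_distrib matrix_vector_mult_scaleR LtL Ltw)
    define h where "h = (A *v u) \<bullet> (H *v y)"
    have "(L *v (A *v u)) \<bullet> z = (A *v u) \<bullet> (transpose L *v z)"
      by (metis inner_commute transpose_inner)
    also have "\<dots> = h + c * a"
      by (simp add: Lz inner_simps h_def a_def inner_commute)
    finally have 1: "(L *v (A *v u)) \<bullet> z = h + c * a" .
    have "w \<bullet> (L *v y) = 0"
      using transpose_inner[of L w y] by (simp add: Ltw uy)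
    then have "w \<bullet> z = c * (n * n)"
      by (simp add: z_def inner_simps ww)
    with 1 have "p \<bullet> z = h + c * a - sqrt a * c * n"
      using n by (simp add: p_def inner_simps)
    also have "\<dots> = h + c * a - (u \<bullet> x)"
      using n a sa by (simp add: c_def field_simps)
    finally have pz: "p \<bullet> z = h + c * a - (u \<bullet> x)" .
    have v: "transpose L' *v (L' *v x) = H *v y + ((u \<bullet> x - h) / a) *\<^sub>R u"
      using a unfolding z L'tz Lz pz
      by (simp add: algebra_simps diff_divide_distrib add_divide_distrib)
    have uGv: "u \<bullet> (G *v (H *v y)) = 0" using uy by (simp add: GH)
    have uAH: "u \<bullet> (A *v (H *v y)) = h"
      unfolding h_def by (rule symmetric_inner[OF sym(2)])
    define r where "r = (u \<bullet> x - h) / a"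
    have ra: "r * a = u \<bullet> x - h" using a by (simp add: r_def)
    \<comment> \<open>The two multiples of \<open>G u\<close> cancel, and
      \<open>h + r a = u \<bullet> x\<close> restores the multiple of \<open>A u\<close> that was
      taken off in \<open>y\<close>.\<close>
    have "BFGS G A u *v (H *v y + r *\<^sub>R u) = y + r *\<^sub>R (G *v u)
        - (r * (n * n) / (n * n)) *\<^sub>R (G *v u) + ((h + r * a) / a) *\<^sub>R (A *v u)"
      unfolding BFGS_mult_vector[OF sym]
      by (simp add: matrix_vector_right_distrib matrix_vector_mult_scaleR GH inner_simps
          uy uGu uAH a_def[symmetric])
    also have "\<dots> = x"
      using n by (simp add: ra y_def)
    finally show ?thesis unfolding v r_def .
  qed
  then have "BFGS G A u ** (transpose L' ** L') = mat 1"
    by (simp add: matrix_eq matrix_vector_mul_assoc)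
  then show ?thesis
    using matrix_inv_eqI unfolding L'_def u_def by metis
qed (use L in simp)

section \<open>The gain matrix and the change of \<sigma> in one step\<close>

text \<open>The matrix of the objective that the greedy method maximises.\<close>

definition gain_matrix :: "real^'d^'d \<Rightarrow> real^'d^'d \<Rightarrow> real^'d^'d" where
  "gain_matrix A L = transpose (matrix_inv L) ** matrix_inv A ** matrix_inv L"

lemma gain_matrix_inner:
  "x \<bullet> (gain_matrix A L *v y) = (matrix_inv L *v x) \<bullet> (matrix_inv A *v (matrix_inv L *v y))"
  by (metis gain_matrix_def inner_commute matrix_vector_mul_assoc transpose_inner)

text \<open>For \<open>y = L^-1 x\<close> the form of \<open>G^-1 = L^T L\<close> at
  \<open>y\<close> is \<open>x \<bullet> x\<close>, and inversion reverses the order of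
  \<open>A\<close> and \<open>G\<close>.\<close>

lemma gain_matrix_ge:
  assumes A: "sym_pos_def A" and le: "A \<preceq>\<^sub>L G" and L: "transpose L ** L = matrix_inv G"
  shows "x \<bullet> x \<le> x \<bullet> (gain_matrix A L *v x)"
proof -
  have G: "sym_pos_def G" using sym_pos_def_mono[OF A le] .
  let ?y = "matrix_inv L *v x"
  have Ly: "L *v ?y = x"
    using factor_matrix_inv[OF G L] by (simp add: matrix_vector_mul_assoc)
  have "?y \<bullet> (matrix_inv G *v ?y) = x \<bullet> x"
    by (metis L Ly inner_commute matrix_vector_mul_assoc transpose_inner)
  then show ?thesis
    using matrix_inv_antimono[OF A le, of ?y] by (simp add: gain_matrix_inner)
qed

text \<open>Cyclicity of the trace brings together \<open>L^-1 L^-T\<close>, which equals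
  \<open>G\<close>.\<close>

lemma trace_gain_matrix:
  fixes A G L :: "real^'d^'d"
  assumes G: "sym_pos_def G" and L: "transpose L ** L = matrix_inv G"
  shows "trace (gain_matrix A L) = bfgs_sigma A G + real CARD('d)"
proof -
  have "transpose G = G" using G by (simp add: sym_pos_def_def)
  then have "matrix_inv L ** transpose (matrix_inv L) = G ** transpose L ** L ** G"
    by (simp add: factor_matrix_inv(2)[OF G L] matrix_transpose_mul matrix_mul_assoc)
  also have "\<dots> = G"
    using L sym_pos_def_matrix_inv[OF G] by (metis matrix_mul_assoc matrix_mul_lid)
  finally have "matrix_inv L ** transpose (matrix_inv L) = G" .
  then show ?thesis
    unfolding gain_matrix_def bfgs_sigma_def
    by (subst trace_mul_sym) (simp add: matrix_mul_assoc)
qed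

text \<open>\<open>gain_matrix_ge\<close> at the basis vectors makes every diagonal entry of the
  gain matrix at least 1, so its trace is at least the dimension.\<close>

lemma bfgs_sigma_nonneg:
  fixes A G L :: "real^'d^'d"
  assumes A: "sym_pos_def A" and le: "A \<preceq>\<^sub>L G" and L: "transpose L ** L = matrix_inv G"
  shows "0 \<le> bfgs_sigma A G"
proof -
  have "1 \<le> gain_matrix A L $ i $ i" for i
    using gain_matrix_ge[OF assms, of "axis i 1"]
    by (simp add: inner_axis' matrix_vector_mul_component inner_axis)
  then have "real CARD('d) \<le> trace (gain_matrix A L)"
    using sum_bounded_below[of "UNIV :: 'd set" 1 "\<lambda>i. gain_matrix A L $ i $ i"]
    by (simp add: trace_def)
  then show ?thesis
    using trace_gain_matrix[OF sym_pos_def_mono[OF A le] L, of A] by simp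
qed

text \<open>After multiplication by \<open>A^-1\<close>, the subtracted rank-one term has the
  Rayleigh quotient as its trace, because \<open>G u = L^-1 w\<close> and
  \<open>u \<bullet> G u = w \<bullet> w\<close>; the added one has trace 1, because
  \<open>A^-1\<close> cancels \<open>A\<close>.\<close>

lemma bfgs_sigma_BFGS:
  assumes A: "sym_pos_def A" and le: "A \<preceq>\<^sub>L G" and L: "transpose L ** L = matrix_inv G"
    and "w \<noteq> 0"
  shows "bfgs_sigma A (BFGS G A (bfgs_dir L w))
         = bfgs_sigma A G + 1 - (w \<bullet> (gain_matrix A L *v w)) / (w \<bullet> w)"
proof -
  have G: "sym_pos_def G" using sym_pos_def_mono[OF A le] .
  have sym: "transpose G = G" "transpose A = A"
    using A G unfolding sym_pos_def_def by auto
  define u where "u = bfgs_dir L w"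
  have "u \<noteq> 0" using factor_bfgs_dir(3)[OF G L] \<open>w \<noteq> 0\<close> by (simp add: u_def)
  then have a: "u \<bullet> (A *v u) > 0" using A unfolding sym_pos_def_def by auto
  have Au: "matrix_inv A *v (A *v u) = u"
    by (simp add: matrix_vector_mul_assoc sym_pos_def_matrix_inv[OF A])
  have Gu: "(G *v u) \<bullet> (matrix_inv A *v (G *v u)) = w \<bullet> (gain_matrix A L *v w)"
    by (simp add: u_def factor_bfgs_dir(1)[OF G L] gain_matrix_inner)
  have "BFGS G A u ** matrix_inv A = G ** matrix_inv A
      - (1 / (w \<bullet> w)) *\<^sub>R (outer (G *v u) (G *v u) ** matrix_inv A)
      + (1 / (u \<bullet> (A *v u))) *\<^sub>R (outer (A *v u) (A *v u) ** matrix_inv A)"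
    using factor_bfgs_dir(2)[OF G L, of w] sym
    by (simp add: BFGS_def matrix_mult_outer_mult u_def matrix_eq
        matrix_vector_mul_assoc[symmetric] matrix_vector_mult_diff_rdistrib
        matrix_vector_mult_add_rdistrib scaleR_matrix_vector_assoc[symmetric])
  then have "trace (BFGS G A u ** matrix_inv A) = trace (G ** matrix_inv A)
      - (w \<bullet> (gain_matrix A L *v w)) / (w \<bullet> w) + ((A *v u) \<bullet> u) / (u \<bullet> (A *v u))"
    by (simp add: trace_add trace_sub trace_scaleR trace_outer_mult Au Gu)
  then show ?thesis
    using a by (simp add: bfgs_sigma_def u_def inner_commute)
qed

text \<open>The Rayleigh quotient is at least 1. Including the zero direction makes the bound hold
  on every path rather than almost surely.\<close>

lemma bfgs_sigma_BFGS_le: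
  assumes "sym_pos_def A" "A \<preceq>\<^sub>L G" "transpose L ** L = matrix_inv G"
  shows "bfgs_sigma A (BFGS G A (bfgs_dir L w)) \<le> bfgs_sigma A G"
proof (cases "w = 0")
  case False
  then have "1 \<le> (w \<bullet> (gain_matrix A L *v w)) / (w \<bullet> w)"
    using gain_matrix_ge[OF assms, of w] by simp
  then show ?thesis
    using bfgs_sigma_BFGS[OF assms False] by simp
qed simp

lemma greedy_direction_nonzero: "greedy_direction A L w \<Longrightarrow> w \<noteq> 0"
  by (auto simp: greedy_direction_def is_arg_max_def axis_eq_0_iff)

text \<open>Basis vectors have norm 1, and the largest diagonal entry of the gain matrix is at least
  the average one, the trace divided by the dimension.\<close>

lemma bfgs_sigma_greedy_le:
  fixes A G L :: "real^'d^'d"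
  assumes A: "sym_pos_def A" and le: "A \<preceq>\<^sub>L G" and L: "transpose L ** L = matrix_inv G"
    and w: "greedy_direction A L w"
  shows "bfgs_sigma A (BFGS G A (bfgs_dir L w)) \<le> (1 - 1 / real CARD('d)) * bfgs_sigma A G"
proof -
  let ?b = "w \<bullet> (gain_matrix A L *v w)"
  have "w \<bullet> w = 1"
    using w by (auto simp: greedy_direction_def is_arg_max_def inner_axis_axis)
  have "gain_matrix A L $ i $ i \<le> ?b" for i
  proof -
    have "axis i 1 \<bullet> (gain_matrix A L *v axis i 1) \<le> ?b"
      using w unfolding greedy_direction_def is_arg_max_def gain_matrix_def
      by (meson linorder_not_le rangeI)
    then show ?thesis
      by (simp add: inner_axis' matrix_vector_mul_component inner_axis)
  qed
  then have "bfgs_sigma A G + real CARD('d) \<le> real CARD('d) * ?b"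
    using trace_gain_matrix[OF sym_pos_def_mono[OF A le] L, of A]
      sum_bounded_above[of "UNIV :: 'd set" "\<lambda>i. gain_matrix A L $ i $ i" ?b]
    by (simp add: trace_def)
  then have "bfgs_sigma A G / real CARD('d) + 1 \<le> ?b"
    by (simp add: field_simps)
  then show ?thesis
    using bfgs_sigma_BFGS[OF A le L greedy_direction_nonzero[OF w]] \<open>w \<bullet> w = 1\<close>
    by (simp add: algebra_simps)
qed

subsection \<open>Measurability and expectations\<close>

lemma borel_measurable_matrix_mult [measurable]:
  fixes f g :: "'a \<Rightarrow> real^'n^'n"
  assumes "f \<in> borel_measurable N" "g \<in> borel_measurable N"
  shows "(\<lambda>x. f x ** g x) \<in> borel_measurable N"
  using assms by (rule borel_measurable_continuous_Pair)
    (auto simp: matrix_matrix_mult_def intro!: continuous_intros continuous_on_vec_lambda)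

lemma borel_measurable_matrix_vector_mult [measurable]:
  fixes f :: "'a \<Rightarrow> real^'n^'n"
  assumes "f \<in> borel_measurable N" "g \<in> borel_measurable N"
  shows "(\<lambda>x. f x *v g x) \<in> borel_measurable N"
  using assms by (rule borel_measurable_continuous_Pair)
    (auto simp: matrix_vector_mult_def intro!: continuous_intros continuous_on_vec_lambda)

lemma borel_measurable_transpose [measurable]:
  fixes f :: "'a \<Rightarrow> real^'n^'n"
  assumes "f \<in> borel_measurable N"
  shows "(\<lambda>x. transpose (f x)) \<in> borel_measurable N"
  using _ assms by (rule borel_measurable_continuous_on)
    (auto simp: transpose_def intro!: continuous_intros continuous_on_vec_lambda)

lemma borel_measurable_outer [measurable]:
  assumes "f \<in> borel_measurable N" "g \<in> borel_measurable N"
  shows "(\<lambda>x. outer (f x) (g x)) \<in> borel_measurable N"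
  using assms by (rule borel_measurable_continuous_Pair)
    (auto simp: outer_def intro!: continuous_intros continuous_on_vec_lambda)

lemma borel_measurable_vec_nth [measurable]:
  fixes f :: "'a \<Rightarrow> ('b::{second_countable_topology, real_normed_vector})^'n"
  assumes "f \<in> borel_measurable N"
  shows "(\<lambda>x. f x $ i) \<in> borel_measurable N"
  using _ assms by (rule borel_measurable_continuous_on) (intro continuous_intros)

lemma borel_measurable_trace [measurable]:
  fixes f :: "'a \<Rightarrow> real^'n^'n"
  assumes [measurable]: "f \<in> borel_measurable N"
  shows "(\<lambda>x. trace (f x)) \<in> borel_measurable N"
  unfolding trace_def by measurable

lemma borel_measurable_bfgs_dir [measurable]:
  assumes [measurable]: "f \<in> borel_measurable N" "g \<in> borel_measurable N"
  shows "(\<lambda>x. bfgs_dir (f x) (g x)) \<in> borel_measurable N"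
  unfolding bfgs_dir_def by measurable

lemma borel_measurable_BFGS [measurable]:
  assumes [measurable]: "f \<in> borel_measurable N" "g \<in> borel_measurable N"
  shows "(\<lambda>x. BFGS (f x) A (g x)) \<in> borel_measurable N"
  unfolding BFGS_def by measurable

lemma borel_measurable_factor_update [measurable]:
  assumes [measurable]: "f \<in> borel_measurable N" "g \<in> borel_measurable N"
  shows "(\<lambda>x. factor_update (f x) A (g x)) \<in> borel_measurable N"
  unfolding factor_update_def Let_def by measurable

lemma borel_measurable_bfgs_sigma [measurable]:
  assumes [measurable]: "f \<in> borel_measurable N"
  shows "(\<lambda>x. bfgs_sigma A (f x)) \<in> borel_measurable N"
  unfolding bfgs_sigma_def by measurable

text \<open>With \<open>N\<close> arbitrary and only directions before \<open>k\<close> assumed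
  measurable, this applies to \<open>M\<close> and also to the sigma-algebra of the past, for which
  later directions need not be measurable.\<close>

lemma borel_measurable_BFGS_iterates:
  assumes "G 0 \<in> borel_measurable N" "L 0 \<in> borel_measurable N"
    and "\<And>j. j < k \<Longrightarrow> w j \<in> borel_measurable N"
    and G: "\<And>k \<omega>. \<omega> \<in> space N \<Longrightarrow> G (Suc k) \<omega> = BFGS (G k \<omega>) A (bfgs_dir (L k \<omega>) (w k \<omega>))"
    and L: "\<And>k \<omega>. \<omega> \<in> space N \<Longrightarrow> L (Suc k) \<omega> = factor_update (L k \<omega>) A (w k \<omega>)"
  shows "G k \<in> borel_measurable N \<and> L k \<in> borel_measurable N"
  using assms(3)
proof (induction k)
  case (Suc k)
  then have [measurable]: "G k \<in> borel_measurable N" "L k \<in> borel_measurable N"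
      "w k \<in> borel_measurable N"
    by auto
  show ?case
    by (simp add: G L cong: measurable_cong)
qed (use assms in simp)

section \<open>Independence and isotropic directions\<close>

text \<open>The sigma-algebras generated by \<open>X\<close> and \<open>Y\<close> lie inside
  \<open>F\<close> and \<open>H\<close>. This leads from the independence in
  \<open>random_method\<close> to real random variables, for which expectations of products
  factor.\<close>

lemma (in prob_space) indep_set_indep_var:
  assumes indep: "indep_set (sets F) (sets H)"
    and space: "space F = space M" "space H = space M"
    and X: "X \<in> F \<rightarrow>\<^sub>M S" and Y: "Y \<in> H \<rightarrow>\<^sub>M T"
  shows "indep_var S X T Y"
proof -
  have sub: "sets F \<subseteq> events" "sets H \<subseteq> events"
    using indep_setD_ev1[OF indep] indep_setD_ev2[OF indep] .
  have "subalgebra M F" "subalgebra M H"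
    using sub space by (auto simp: subalgebra_def)
  then have rv: "random_variable S X" "random_variable T Y"
    using X Y measurable_from_subalg by blast+
  have "sigma_sets (space M) {X -` A \<inter> space M |A. A \<in> sets S} \<subseteq> sets F"
    using measurable_sets[OF X] space by (intro sets.sigma_sets_subset[of _ F, unfolded space]) auto
  moreover have "sigma_sets (space M) {Y -` A \<inter> space M |A. A \<in> sets T} \<subseteq> sets H"
    using measurable_sets[OF Y] space by (intro sets.sigma_sets_subset[of _ H, unfolded space]) auto
  ultimately show ?thesis
    using indep rv unfolding indep_var_eq indep_sets2_eq by blast
qed

text \<open>Isotropy read entrywise: the matrix-valued integrand is bounded, hence integrable, so
  taking an entry, a bounded linear map, commutes with the integral.\<close>

lemma isotropic_quotient_integral:
  fixes D :: "(real^'d) measure"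
  assumes "isotropic_distribution D"
  shows "integrable D (\<lambda>w. w $ i * w $ j / (w \<bullet> w))"
    and "(\<integral>w. w $ i * w $ j / (w \<bullet> w) \<partial>D) = (if i = j then 1 / real CARD('d) else 0)"
proof -
  interpret D: prob_space D
    using assms by (simp add: isotropic_distribution_def)
  have [measurable_cong]: "sets D = sets borel"
    using assms by (simp add: isotropic_distribution_def)
  have bound: "\<bar>w $ i * w $ j / (w \<bullet> w)\<bar> \<le> 1" for w :: "real^'d" and i j
  proof -
    have "\<bar>w $ i\<bar> * \<bar>w $ j\<bar> \<le> norm w * norm w"
      by (intro mult_mono component_le_norm_cart) auto
    then show ?thesis
      \<comment> \<open>At 0 the quotient is 0 by the convention for division.\<close>
      by (cases "w = 0") (simp_all add: abs_mult dot_square_norm power2_eq_square divide_le_eq_1)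
  qed
  have comp: "((1 / (w \<bullet> w)) *\<^sub>R outer w w) $ i $ j = w $ i * w $ j / (w \<bullet> w)" for w :: "real^'d" and i j
    by (simp add: outer_def)
  show int: "integrable D (\<lambda>w. w $ i * w $ j / (w \<bullet> w))" for i j
    by (rule D.integrable_const_bound[where B=1]) (use bound in auto)
  have "integrable D (\<lambda>w. (1 / (w \<bullet> w)) *\<^sub>R outer w w)"
  \<comment> \<open>Entries are at most 1 in absolute value, so each row has norm at most the
    dimension, and there are as many rows.\<close>
  proof (rule D.integrable_const_bound[where B="real CARD('d) * real CARD('d)"])
    have "norm ((1 / (w \<bullet> w)) *\<^sub>R outer w w) \<le> real CARD('d) * real CARD('d)" for w :: "real^'d"
    proof -
      have "norm (((1 / (w \<bullet> w)) *\<^sub>R outer w w) $ i) \<le> real CARD('d)" for i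
      proof (rule order_trans[OF norm_le_l1_cart])
        show "(\<Sum>j\<in>UNIV. \<bar>((1 / (w \<bullet> w)) *\<^sub>R outer w w) $ i $ j\<bar>) \<le> real CARD('d)"
          unfolding comp
          using sum_bounded_above[of "UNIV :: 'd set" "\<lambda>j. \<bar>w $ i * w $ j / (w \<bullet> w)\<bar>" 1] bound
          by simp
      qed
      then have "(\<Sum>i\<in>UNIV. norm (((1 / (w \<bullet> w)) *\<^sub>R outer w w) $ i)) \<le> real CARD('d) * real CARD('d)"
        using sum_bounded_above[of "UNIV :: 'd set"
            "\<lambda>i. norm (((1 / (w \<bullet> w)) *\<^sub>R outer w w) $ i)" "real CARD('d)"]
        by simp
      moreover have "norm ((1 / (w \<bullet> w)) *\<^sub>R outer w w)
          \<le> (\<Sum>i\<in>UNIV. norm (((1 / (w \<bullet> w)) *\<^sub>R outer w w) $ i))"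
        unfolding norm_vec_def by (rule L2_set_le_sum) simp
      ultimately show ?thesis by linarith
    qed
    then show "AE w in D. norm ((1 / (w \<bullet> w)) *\<^sub>R outer w w) \<le> real CARD('d) * real CARD('d)"
      by simp
  qed measurable
  then have "(\<integral>w. ((1 / (w \<bullet> w)) *\<^sub>R outer w w) $ i $ j \<partial>D)
      = (\<integral>w. (1 / (w \<bullet> w)) *\<^sub>R outer w w \<partial>D) $ i $ j"
    by (intro integral_bounded_linear
        bounded_linear_compose[OF bounded_linear_vec_nth bounded_linear_vec_nth])
  then show "(\<integral>w. w $ i * w $ j / (w \<bullet> w) \<partial>D) = (if i = j then 1 / real CARD('d) else 0)"
    unfolding comp using assms by (simp add: isotropic_distribution_def mat_def)
qed

text \<open>The Rayleigh quotient is a double sum of entries of \<open>B\<close> times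
  \<open>w_i w_j / (w \<bullet> w)\<close>. Independence splits each expectation; isotropy removes
  the off-diagonal terms and puts the factor \<open>1/d\<close> on the diagonal ones.\<close>

lemma (in prob_space) isotropic_rayleigh_expectation:
  fixes B :: "'a \<Rightarrow> real^'d^'d" and w :: "'a \<Rightarrow> real^'d"
  assumes D: "isotropic_distribution D"
    and w: "w \<in> borel_measurable M" "distr M borel w = D"
    and indep: "indep_set (sets F) (sets (vimage_algebra (space M) w borel))"
    and F: "space F = space M" "B \<in> borel_measurable F"
    and int: "\<And>i j. integrable M (\<lambda>\<omega>. B \<omega> $ i $ j)"
  shows "integrable M (\<lambda>\<omega>. (w \<omega> \<bullet> (B \<omega> *v w \<omega>)) / (w \<omega> \<bullet> w \<omega>))"
    and "(\<integral>\<omega>. (w \<omega> \<bullet> (B \<omega> *v w \<omega>)) / (w \<omega> \<bullet> w \<omega>) \<partial>M) = (\<integral>\<omega>. trace (B \<omega>) \<partial>M) / real CARD('d)"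
proof -
  let ?q = "\<lambda>i j v :: real^'d. v $ i * v $ j / (v \<bullet> v)"
  note [measurable] = w(1)
  have q: "?q i j \<in> borel_measurable borel" for i j
    by measurable
  have W: "integrable M (\<lambda>\<omega>. ?q i j (w \<omega>))"
      "(\<integral>\<omega>. ?q i j (w \<omega>) \<partial>M) = (if i = j then 1 / real CARD('d) else 0)" for i j
    using isotropic_quotient_integral[OF D, of i j] q[of i j] unfolding w(2)[symmetric]
    by (simp_all add: integrable_distr_eq integral_distr)
  have iv: "indep_var borel (\<lambda>\<omega>. B \<omega> $ i $ j) borel (\<lambda>\<omega>. ?q i j (w \<omega>))" for i j
  proof (rule indep_set_indep_var[OF indep F(1)])
    show "(\<lambda>\<omega>. B \<omega> $ i $ j) \<in> borel_measurable F"
      using F(2) by measurable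
    show "(\<lambda>\<omega>. ?q i j (w \<omega>)) \<in> borel_measurable (vimage_algebra (space M) w borel)"
      by (rule measurable_compose[OF measurable_vimage_algebra1 q]) simp
  qed simp
  have eq: "(v \<bullet> (K *v v)) / (v \<bullet> v) = (\<Sum>i\<in>UNIV. \<Sum>j\<in>UNIV. K $ i $ j * ?q i j v)"
    for v :: "real^'d" and K :: "real^'d^'d"
  proof -
    have "v \<bullet> (K *v v) = (\<Sum>i\<in>UNIV. \<Sum>j\<in>UNIV. K $ i $ j * (v $ i * v $ j))"
      by (simp add: inner_vec_def matrix_vector_mult_def sum_distrib_left algebra_simps)
    then show ?thesis
      by (simp add: sum_divide_distrib)
  qed
  have BW: "integrable M (\<lambda>\<omega>. B \<omega> $ i $ j * ?q i j (w \<omega>))"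
    "(\<integral>\<omega>. B \<omega> $ i $ j * ?q i j (w \<omega>) \<partial>M)
     = (if i = j then (\<integral>\<omega>. B \<omega> $ i $ j \<partial>M) / real CARD('d) else 0)" for i j
    using indep_var_integrable[OF iv int W(1), of i j]
      indep_var_lebesgue_integral[OF iv int W(1), of i j] W(2)[of i j] by simp_all
  show "integrable M (\<lambda>\<omega>. (w \<omega> \<bullet> (B \<omega> *v w \<omega>)) / (w \<omega> \<bullet> w \<omega>))"
    unfolding eq by (intro Bochner_Integration.integrable_sum BW)
  have "(\<integral>\<omega>. (w \<omega> \<bullet> (B \<omega> *v w \<omega>)) / (w \<omega> \<bullet> w \<omega>) \<partial>M)
      = (\<Sum>i\<in>UNIV. \<Sum>j\<in>UNIV. \<integral>\<omega>. B \<omega> $ i $ j * ?q i j (w \<omega>) \<partial>M)"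
    unfolding eq
    by (simp only: Bochner_Integration.integral_sum Bochner_Integration.integrable_sum BW(1))
  also have "\<dots> = (\<integral>\<omega>. trace (B \<omega>) \<partial>M) / real CARD('d)"
    unfolding BW(2)
    by (simp add: trace_def Bochner_Integration.integral_sum int sum_divide_distrib)
  finally show "(\<integral>\<omega>. (w \<omega> \<bullet> (B \<omega> *v w \<omega>)) / (w \<omega> \<bullet> w \<omega>) \<partial>M)
    = (\<integral>\<omega>. trace (B \<omega>) \<partial>M) / real CARD('d)" .
qed

text \<open>Nonnegativity at \<open>e_i - e_j\<close> and \<open>e_i + e_j\<close> bounds an entry
  by the mean of two diagonal entries. It lets the integrable trace dominate all entries of the
  random gain matrix.\<close>

lemma abs_component_le_trace:
  fixes B :: "real^'n^'n"
  assumes "transpose B = B" and pos: "\<And>x. 0 \<le> x \<bullet> (B *v x)"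
  shows "\<bar>B $ i $ j\<bar> \<le> trace B"
proof -
  have diag: "axis k 1 \<bullet> (B *v axis l 1) = B $ k $ l" for k l
    by (simp add: inner_axis' matrix_vector_mul_component inner_axis)
  have "B $ k $ k \<le> trace B" for k
    unfolding trace_def using pos[of "axis _ 1"] by (intro member_le_sum) (auto simp: diag)
  moreover have "0 \<le> B $ i $ i - 2 * t * B $ j $ i + t\<^sup>2 * B $ j $ j" for t
    using pos[of "axis i 1 - t *\<^sub>R axis j 1"]
    by (simp add: symmetric_form_diff_scaleR[OF assms(1)] diag)
  from this[of 1] this[of "-1"] have "2 * \<bar>B $ j $ i\<bar> \<le> B $ i $ i + B $ j $ j"
    by simp
  moreover have "B $ j $ i = B $ i $ j"
    using assms(1) by (metis transpose_def vec_lambda_beta)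
  ultimately show ?thesis
    by (smt (verit))
qed

lemma transpose_gain_matrix:
  assumes "sym_pos_def A"
  shows "transpose (gain_matrix A L) = gain_matrix A L"
proof -
  have "transpose A = A" using assms by (simp add: sym_pos_def_def)
  then have "A ** transpose (matrix_inv A) = mat 1"
    using sym_pos_def_matrix_inv(2)[OF assms] by (metis matrix_transpose_mul transpose_mat)
  then have "transpose (matrix_inv A) = matrix_inv A"
    using matrix_inv_eqI by metis
  then show ?thesis
    by (simp add: gain_matrix_def matrix_transpose_mul matrix_mul_assoc)
qed

section \<open>R-linear convergence from a geometric bound\<close>

lemma converges_R_linearly_geometric:
  assumes "0 \<le> r" "r < 1" and "\<And>k. 0 \<le> y k" "\<And>k. y k \<le> r ^ k * y 0"
  shows "converges_R_linearly y 0"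
proof -
  \<comment> \<open>The rate must be positive, but \<open>r\<close> may be 0, as it is in dimension
    1.\<close>
  define q where "q = max r (1 / 2)"
  have q: "0 < q" "q < 1" "r \<le> q" using assms by (auto simp: q_def)
  \<comment> \<open>Adding 1 keeps \<open>x\<close> nonzero when \<open>y 0 = 0\<close>, so that all
    ratios equal \<open>q\<close>.\<close>
  define x where "x k = q ^ k * (y 0 + 1)" for k
  have pos: "y 0 + 1 > 0" using assms(3)[of 0] by simp
  have "x \<longlonglongrightarrow> 0"
    unfolding x_def using q by (auto intro!: tendsto_mult_left_zero LIMSEQ_realpow_zero)
  moreover have "\<bar>x (Suc k)\<bar> / \<bar>x k\<bar> = q" for k
    using q pos by (simp add: x_def abs_mult)
  moreover have "\<bar>y k - 0\<bar> \<le> \<bar>x k\<bar>" for k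
  proof -
    have "y k \<le> r ^ k * y 0" by (rule assms)
    also have "\<dots> \<le> q ^ k * (y 0 + 1)"
      using assms q by (intro mult_mono power_mono) auto
    finally show ?thesis
      using assms(3)[of k] q pos by (simp add: x_def abs_mult)
  qed
  ultimately show ?thesis
    unfolding converges_R_linearly_def using q by (intro exI[of _ x] exI[of _ q]) auto
qed

subsection \<open>The BFGS iteration\<close>

text \<open>The rule selecting the directions is left out, so that the pathwise facts and
  integrability serve both methods; each expectation lemma adds its own rule.\<close>

locale bfgs_iteration = prob_space M for M :: "'w measure" +
  fixes A :: "real^'d^'d"
    and G L :: "nat \<Rightarrow> 'w \<Rightarrow> real^'d^'d"
    and w :: "nat \<Rightarrow> 'w \<Rightarrow> real^'d"
  assumes A: "sym_pos_def A"
    and G0_measurable: "G 0 \<in> borel_measurable M"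
    and L0_measurable: "L 0 \<in> borel_measurable M"
    and w_measurable: "\<And>k. w k \<in> borel_measurable M"
    and le0: "\<And>\<omega>. \<omega> \<in> space M \<Longrightarrow> A \<preceq>\<^sub>L G 0 \<omega>"
    and factor0: "\<And>\<omega>. \<omega> \<in> space M \<Longrightarrow> transpose (L 0 \<omega>) ** L 0 \<omega> = matrix_inv (G 0 \<omega>)"
    and G_Suc: "\<And>k \<omega>. \<omega> \<in> space M \<Longrightarrow> G (Suc k) \<omega> = BFGS (G k \<omega>) A (bfgs_dir (L k \<omega>) (w k \<omega>))"
    and L_Suc: "\<And>k \<omega>. \<omega> \<in> space M \<Longrightarrow> L (Suc k) \<omega> = factor_update (L k \<omega>) A (w k \<omega>)"
    and integrable0: "integrable M (\<lambda>\<omega>. bfgs_sigma A (G 0 \<omega>))"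
begin

text \<open>Proved jointly, since the next factor identity relies on the current order
  relation.\<close>

lemma iterates:
  assumes "\<omega> \<in> space M"
  shows "A \<preceq>\<^sub>L G k \<omega>" and "transpose (L k \<omega>) ** L k \<omega> = matrix_inv (G k \<omega>)"
proof -
  have "A \<preceq>\<^sub>L G k \<omega> \<and> transpose (L k \<omega>) ** L k \<omega> = matrix_inv (G k \<omega>)"
    by (induction k)
      (use assms A in \<open>auto simp: le0 factor0 G_Suc L_Suc intro: loewner_le_BFGS factor_update_factor\<close>)
  then show "A \<preceq>\<^sub>L G k \<omega>" "transpose (L k \<omega>) ** L k \<omega> = matrix_inv (G k \<omega>)"
    by auto
qed

lemma sigma_nonneg: "\<omega> \<in> space M \<Longrightarrow> 0 \<le> bfgs_sigma A (G k \<omega>)"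
  using bfgs_sigma_nonneg[OF A] iterates by blast

lemma sigma_le: "\<omega> \<in> space M \<Longrightarrow> bfgs_sigma A (G k \<omega>) \<le> bfgs_sigma A (G 0 \<omega>)"
proof (induction k)
  case (Suc k)
  then show ?case
    using bfgs_sigma_BFGS_le[OF A iterates(1)[of \<omega> k] iterates(2)[of \<omega> k], of "w k \<omega>"] by (simp add: G_Suc)
qed simp

lemma G_measurable [measurable]: "G k \<in> borel_measurable M"
  using borel_measurable_BFGS_iterates[OF G0_measurable L0_measurable w_measurable G_Suc L_Suc]
  by blast

text \<open>On every path \<sigma> stays between 0 and its integrable initial value.\<close>

lemma sigma_integrable: "integrable M (\<lambda>\<omega>. bfgs_sigma A (G k \<omega>))"
proof (rule Bochner_Integration.integrable_bound[OF integrable0])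
  show "AE \<omega> in M. norm (bfgs_sigma A (G k \<omega>)) \<le> norm (bfgs_sigma A (G 0 \<omega>))"
    using sigma_nonneg sigma_le by (intro AE_I2) (smt (verit) real_norm_def)
qed measurable

section \<open>The recursion for the expected \<sigma>\<close>

lemma expectation_sigma_greedy:
  assumes "greedy_method M A L w"
  shows "expectation (\<lambda>\<omega>. bfgs_sigma A (G (Suc k) \<omega>))
         \<le> (1 - 1 / real CARD('d)) * expectation (\<lambda>\<omega>. bfgs_sigma A (G k \<omega>))"
proof -
  have "expectation (\<lambda>\<omega>. bfgs_sigma A (G (Suc k) \<omega>))
      \<le> expectation (\<lambda>\<omega>. (1 - 1 / real CARD('d)) * bfgs_sigma A (G k \<omega>))"
  proof (rule integral_mono)
    fix \<omega> assume "\<omega> \<in> space M"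
    then show "bfgs_sigma A (G (Suc k) \<omega>) \<le> (1 - 1 / real CARD('d)) * bfgs_sigma A (G k \<omega>)"
      using assms bfgs_sigma_greedy_le[OF A iterates(1)[of \<omega> k] iterates(2)[of \<omega> k], of "w k \<omega>"]
      by (simp add: greedy_method_def G_Suc)
  qed (use sigma_integrable in auto)
  then show ?thesis by simp
qed

text \<open>The gain matrix at step \<open>k\<close> is determined by the past, hence independent of
  \<open>w k\<close>, so the mean Rayleigh quotient is known exactly.\<close>

lemma expectation_sigma_random:
  assumes D: "isotropic_distribution D" and random: "random_method M D (G 0) (L 0) w"
  shows "expectation (\<lambda>\<omega>. bfgs_sigma A (G (Suc k) \<omega>))
         = (1 - 1 / real CARD('d)) * expectation (\<lambda>\<omega>. bfgs_sigma A (G k \<omega>))"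
proof -
  define P where "P = (borel \<Otimes>\<^sub>M borel \<Otimes>\<^sub>M (\<Pi>\<^sub>M j\<in>{..<k}. borel)
    :: ((real^'d^'d) \<times> (real^'d^'d) \<times> (nat \<Rightarrow> real^'d)) measure)"
  define h where "h \<omega> = (G 0 \<omega>, L 0 \<omega>, \<lambda>j\<in>{..<k}. w j \<omega>)" for \<omega>
  define F where "F = vimage_algebra (space M) h P"
  have distr: "distr M borel (w k) = D"
    and indep: "indep_set (sets F) (sets (vimage_algebra (space M) (w k) borel))"
    using random unfolding random_method_def F_def h_def P_def by auto
  have spF: "space F = space M" by (simp add: F_def)
  have h: "h \<in> F \<rightarrow>\<^sub>M P"
    unfolding F_def by (rule measurable_vimage_algebra1) (auto simp: h_def P_def space_pair_measure space_PiM)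
  have "(\<lambda>\<omega>. fst (h \<omega>)) \<in> borel_measurable F" "(\<lambda>\<omega>. fst (snd (h \<omega>))) \<in> borel_measurable F"
    using h unfolding P_def by measurable
  then have GL0: "G 0 \<in> borel_measurable F" "L 0 \<in> borel_measurable F"
    by (simp_all add: h_def)
  have "w j \<in> borel_measurable F" if "j < k" for j
  proof -
    have [measurable]: "j \<in> {..<k}" using that by simp
    have "(\<lambda>\<omega>. snd (snd (h \<omega>)) j) \<in> borel_measurable F"
      using h unfolding P_def by measurable
    then show ?thesis using that by (simp add: h_def)
  qed
  with GL0 have GLk [measurable]: "G k \<in> borel_measurable F" "L k \<in> borel_measurable F"
    using borel_measurable_BFGS_iterates[of G F L k w A] G_Suc L_Suc spF by auto
  have pos: "sym_pos_def (G k \<omega>)" if "\<omega> \<in> space M" for \<omega>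
    using sym_pos_def_mono[OF A iterates(1)[OF that]] .
  let ?B = "\<lambda>\<omega>. gain_matrix A (L k \<omega>)"
  \<comment> \<open>On the sample space the inverse of \<open>L k\<close> is \<open>G k\<close>
    times the transpose of \<open>L k\<close>, which is measurable; \<open>matrix_inv A\<close> is
    constant.\<close>
  have BF: "?B \<in> borel_measurable F"
  proof -
    let ?C = "\<lambda>\<omega>. G k \<omega> ** transpose (L k \<omega>)"
    have "(\<lambda>\<omega>. transpose (?C \<omega>) ** matrix_inv A ** ?C \<omega>) \<in> borel_measurable F"
      by measurable
    moreover have "?B \<omega> = transpose (?C \<omega>) ** matrix_inv A ** ?C \<omega>" if "\<omega> \<in> space F" for \<omega>
      using that by (simp add: spF gain_matrix_def factor_matrix_inv(2)[OF pos iterates(2)])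
    ultimately show ?thesis
      by (simp cong: measurable_cong)
  qed
  have "subalgebra M F"
    using indep_setD_ev1[OF indep] spF by (simp add: subalgebra_def)
  then have BM [measurable]: "?B \<in> borel_measurable M"
    using BF measurable_from_subalg by blast
  have tr: "trace (?B \<omega>) = bfgs_sigma A (G k \<omega>) + real CARD('d)" if "\<omega> \<in> space M" for \<omega>
    using trace_gain_matrix[OF pos iterates(2)] that by blast
  have "integrable M (\<lambda>\<omega>. bfgs_sigma A (G k \<omega>) + real CARD('d))"
    using sigma_integrable by simp
  then have trint: "integrable M (\<lambda>\<omega>. trace (?B \<omega>))"
    by (simp add: tr cong: Bochner_Integration.integrable_cong)
  have Bint: "integrable M (\<lambda>\<omega>. ?B \<omega> $ i $ j)" for i j
  proof (rule Bochner_Integration.integrable_bound[OF trint])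
    have "\<bar>?B \<omega> $ i $ j\<bar> \<le> trace (?B \<omega>)" if "\<omega> \<in> space M" for \<omega>
    proof (rule abs_component_le_trace[OF transpose_gain_matrix[OF A]])
      show "0 \<le> x \<bullet> (?B \<omega> *v x)" for x
        using gain_matrix_ge[OF A iterates(1,2)] that by (meson inner_ge_zero order_trans)
    qed
    then show "AE \<omega> in M. norm (?B \<omega> $ i $ j) \<le> norm (trace (?B \<omega>))"
      by (intro AE_I2) fastforce
  qed measurable
  let ?b = "\<lambda>\<omega>. (w k \<omega> \<bullet> (?B \<omega> *v w k \<omega>)) / (w k \<omega> \<bullet> w k \<omega>)"
  note b = isotropic_rayleigh_expectation[OF D w_measurable distr indep spF BF Bint]
  \<comment> \<open>The one-step formula for \<sigma> requires a nonzero direction, known here only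
    almost surely.\<close>
  have "AE v in distr M borel (w k). v \<noteq> 0"
    unfolding distr using D by (simp add: isotropic_distribution_def)
  then have "AE \<omega> in M. w k \<omega> \<noteq> 0"
    by (subst (asm) AE_distr_iff) (auto simp: w_measurable)
  then have "AE \<omega> in M. bfgs_sigma A (G (Suc k) \<omega>) = bfgs_sigma A (G k \<omega>) + 1 - ?b \<omega>"
    using bfgs_sigma_BFGS[OF A iterates(1,2)] by (auto simp: G_Suc)
  then have "expectation (\<lambda>\<omega>. bfgs_sigma A (G (Suc k) \<omega>))
      = expectation (\<lambda>\<omega>. bfgs_sigma A (G k \<omega>) + 1 - ?b \<omega>)"
    using b(1) sigma_integrable by (intro integral_cong_AE) auto
  also have "\<dots> = expectation (\<lambda>\<omega>. bfgs_sigma A (G k \<omega>)) + 1 - expectation (\<lambda>\<omega>. trace (?B \<omega>)) / real CARD('d)"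
    using b sigma_integrable by (simp add: prob_space)
  \<comment> \<open>With \<open>E\<close> the expected \<sigma>, this gives
    \<open>E + 1 - (E + d) / d = (1 - 1/d) E\<close>.\<close>
  also have "expectation (\<lambda>\<omega>. trace (?B \<omega>)) = expectation (\<lambda>\<omega>. bfgs_sigma A (G k \<omega>)) + real CARD('d)"
    using sigma_integrable by (simp add: tr prob_space cong: Bochner_Integration.integral_cong)
  finally show ?thesis
    by (simp add: field_simps)
qed

end

theorem theorem14:
  fixes M :: "'w measure"
    and A :: "real^'d^'d"
    and G L :: "nat \<Rightarrow> 'w \<Rightarrow> real^'d^'d"
    and w :: "nat \<Rightarrow> 'w \<Rightarrow> real^'d"
  assumes "prob_space M"
    and "sym_pos_def A"
    and "G 0 \<in> borel_measurable M" and "L 0 \<in> borel_measurable M"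
    and "\<And>\<omega>. \<omega> \<in> space M \<Longrightarrow> A \<preceq>\<^sub>L G 0 \<omega>"
    and "\<And>\<omega>. \<omega> \<in> space M \<Longrightarrow> transpose (L 0 \<omega>) ** L 0 \<omega> = matrix_inv (G 0 \<omega>)"
    and "\<And>k \<omega>. \<omega> \<in> space M \<Longrightarrow> G (Suc k) \<omega> = BFGS (G k \<omega>) A (bfgs_dir (L k \<omega>) (w k \<omega>))"
    and "\<And>k \<omega>. \<omega> \<in> space M \<Longrightarrow> L (Suc k) \<omega> = factor_update (L k \<omega>) A (w k \<omega>)"
    and "greedy_method M A L w \<or>
         (\<exists>D. isotropic_distribution D \<and> random_method M D (G 0) (L 0) w)"
    and "integrable M (\<lambda>\<omega>. bfgs_sigma A (G 0 \<omega>))"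
  shows "(\<forall>k. (\<forall>\<omega>\<in>space M. A \<preceq>\<^sub>L G k \<omega>) \<and>
              integrable M (\<lambda>\<omega>. bfgs_sigma A (G k \<omega>)) \<and>
              0 \<le> (\<integral>\<omega>. bfgs_sigma A (G k \<omega>) \<partial>M) \<and>
              (\<integral>\<omega>. bfgs_sigma A (G k \<omega>) \<partial>M)
                \<le> (1 - 1 / real CARD('d)) ^ k * (\<integral>\<omega>. bfgs_sigma A (G 0 \<omega>) \<partial>M)) \<and>
         converges_R_linearly (\<lambda>k. \<integral>\<omega>. bfgs_sigma A (G k \<omega>) \<partial>M) 0"
proof -
  have "\<And>k. w k \<in> borel_measurable M"
    using assms(9) unfolding greedy_method_def random_method_def by blast
  then interpret bfgs_iteration M A G L w
    using assms unfolding bfgs_iteration_def bfgs_iteration_axioms_def by blast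
  define s where "s k = expectation (\<lambda>\<omega>. bfgs_sigma A (G k \<omega>))" for k
  define r where "r = 1 - 1 / real CARD('d)"
  have r: "0 \<le> r" "r < 1"
    by (simp_all add: r_def Suc_leI)
  \<comment> \<open>The random method yields equality, the greedy method an inequality.\<close>
  have step: "s (Suc k) \<le> r * s k" for k
    using assms(9) expectation_sigma_greedy expectation_sigma_random
    unfolding s_def r_def by (metis order_refl)
  have nonneg: "0 \<le> s k" for k
    unfolding s_def using sigma_nonneg by (intro Bochner_Integration.integral_nonneg) auto
  have bound: "s k \<le> r ^ k * s 0" for k
  proof (induction k)
    case (Suc k)
    have "s (Suc k) \<le> r * (r ^ k * s 0)"
      using step[of k] mult_left_mono[OF Suc r(1)] by linarith
    then show ?case by simp
  qed simp
  have "converges_R_linearly s 0"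
    using r nonneg bound by (rule converges_R_linearly_geometric)
  then show ?thesis
    using iterates(1) sigma_integrable nonneg bound unfolding s_def r_def by blast
qed

end
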